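(* Let $n\geq 6$ be an integer, and consider the subsets of $\mathrm{Dic}_{4n}$ of the form $A=R\cup Sb$, where $$R=\{a^{r},a^{r+1},\ldots,a^{r+n-1}\}\quad\text{for some integer } 0\leq r\leq n,$$ and $$S=\{a^{i_1},a^{i_2},\ldots,a^{i_n}\}\subset\{1,a,\ldots,a^{2n-1}\},\qquad 0\leq i_1,i_2,\ldots,i_n\leq 2n-1,$$ with $i_1,\dots,i_n$ pairwise distinct (so that $|A|=2n$). Let $\mathrm{S}_{\mathrm{Dic}_{4n}}(2n,A)$, $\mathrm{D}_{\mathrm{Dic}_{4n}}(2n,A)$, $\mathrm{B}_{\mathrm{Dic}_{4n}}(2n,A)$ denote the numbers of MSTD, MDTS, and balanced subsets, respectively, among all subsets of this form (over all choices of $r$ and $S$). Then the following hold. (1) If $n$ is even, then $$\mathrm{S}_{\mathrm{Dic}_{4n}}(2n,A)\geq (n+1)\bigl(7\cdot 2^{n-3}-4\bigr),\qquad \mathrm{D}_{\mathrm{Dic}_{4n}}(2n,A)\geq 2(n+1),\qquad \mathrm{B}_{\mathrm{Dic}_{4n}}(2n,A)\geq (n+1)\sum_{\substack{i=3\\ i\text{ odd}}}^{n+3}\binom{2n-i}{n-3}.$$ (2) If $n$ is odd, then $$\mathrm{S}_{\mathrm{Dic}_{4n}}(2n,A)\geq (n+1)\bigl(7\cdot 2^{n-3}-4\bigr),\qquad \mathrm{D}_{\mathrm{Dic}_{4n}}(2n,A)=0,\qquad \mathrm{B}_{\mathrm{Dic}_{4n}}(2n,A)\geq \binom{2n}{n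}(n+1)-2^{n}(n+1).$$
   Context: For a positive integer $n$, the dicyclic group is $\mathrm{Dic}_{4n}=\langle a,b : a^{2n}=1,\ a^{n}=b^2,\ b^{-1}ab=a^{-1}\rangle$, a group of order $4n$ with elements $1,a,\dots,a^{2n-1},b,ab,\dots,a^{2n-1}b$. Here $Sb=\{sb: s\in S\}$, and exponents of $a$ are read modulo $2n$. For a subset $A$ of a finite (multiplicatively written) group, put $A+A=\{a_1a_2: a_1,a_2\in A\}$ and $A-A=\{a_1a_2^{-1}: a_1,a_2\in A\}$. The set $A$ is MSTD if $|A+A|>|A-A|$, balanced if $|A+A|=|A-A|$, and MDTS if $|A+A|<|A-A|$. *)

theory Defs
  imports Complex_Main "HOL-Algebra.Generated_Groups"
begin

text \<open>Generation by a and b together with the relations forces the group to be a quotient of the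
  presented group, whose order is 4 n; the condition on the order therefore says that no
  further relations hold, i.e. that G is the presented group.\<close>

locale dicyclic = group G for G (structure) +
  fixes n :: nat and a b :: 'a
  assumes n_pos: "n > 0"
    and a_carrier: "a \<in> carrier G"
    and b_carrier: "b \<in> carrier G"
    and generated: "generate G {a, b} = carrier G"
    and order_eq: "order G = 4 * n"
    and rel_a: "a [^] (2 * n) = \<one>"
    and rel_ab: "a [^] n = b [^] (2 :: nat)"
    and rel_conj: "inv b \<otimes> a \<otimes> b = inv a"

definition sum_set :: "('a, 'm) monoid_scheme \<Rightarrow> 'a set \<Rightarrow> 'a set" where
  "sum_set G A = A <#>\<^bsub>G\<^esub> A"

definition diff_set :: "('a, 'm) monoid_scheme \<Rightarrow> 'a set \<Rightarrow> 'a set" where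
  "diff_set G A = A <#>\<^bsub>G\<^esub> set_inv\<^bsub>G\<^esub> A"

definition MSTD :: "('a, 'm) monoid_scheme \<Rightarrow> 'a set \<Rightarrow> bool" where
  "MSTD G A \<longleftrightarrow> card (sum_set G A) > card (diff_set G A)"

definition balanced :: "('a, 'm) monoid_scheme \<Rightarrow> 'a set \<Rightarrow> bool" where
  "balanced G A \<longleftrightarrow> card (sum_set G A) = card (diff_set G A)"

definition MDTS :: "('a, 'm) monoid_scheme \<Rightarrow> 'a set \<Rightarrow> bool" where
  "MDTS G A \<longleftrightarrow> card (sum_set G A) < card (diff_set G A)"

definition dic_family :: "('a, 'm) monoid_scheme \<Rightarrow> nat \<Rightarrow> 'a \<Rightarrow> 'a \<Rightarrow> 'a set set" where
  "dic_family G n a b =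
     {R \<union> (S #>\<^bsub>G\<^esub> b) | R S.
        (\<exists>r\<le>n. R = (\<lambda>k. a [^]\<^bsub>G\<^esub> k) ` {r..<r + n}) \<and>
        S \<subseteq> (\<lambda>k. a [^]\<^bsub>G\<^esub> k) ` {0..<2 * n} \<and> card S = n}"

text \<open>A concrete model: the pair (i, e) stands for the i-th power of a, followed by b if e holds.
  It shows that the locale is inhabited for every positive n.\<close>

definition dic_model :: "nat \<Rightarrow> (int \<times> bool) monoid" where
  "dic_model n =
     \<lparr>carrier = {0..<2 * int n} \<times> UNIV,
      mult = (\<lambda>(i, e) (j, f).
        ((i + (if e then - j else j) + (if e \<and> f then int n else 0)) mod (2 * int n), e \<noteq> f)),
      one = (0, False)\<rparr>"

lemma dic_model_group:
  assumes "n > 0"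
  shows "group (dic_model n)"
proof (rule groupI)
  fix x y z
  assume x: "x \<in> carrier (dic_model n)" and y: "y \<in> carrier (dic_model n)"
    and z: "z \<in> carrier (dic_model n)"
  show "x \<otimes>\<^bsub>dic_model n\<^esub> y \<in> carrier (dic_model n)"
    using assms by (auto simp: dic_model_def split: prod.splits)
  obtain i e j f k g where [simp]: "x = (i, e)" "y = (j, f)" "z = (k, g)"
    by (metis surj_pair)
  show "x \<otimes>\<^bsub>dic_model n\<^esub> y \<otimes>\<^bsub>dic_model n\<^esub> z = x \<otimes>\<^bsub>dic_model n\<^esub> (y \<otimes>\<^bsub>dic_model n\<^esub> z)"
    by (cases e; cases f; cases g; simp add: dic_model_def mod_simps)
      (simp_all add: mod_eq_dvd_iff, simp_all add: minus_mult_div_eq_mod [symmetric])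
next
  show "\<one>\<^bsub>dic_model n\<^esub> \<in> carrier (dic_model n)"
    using assms by (simp add: dic_model_def)
next
  fix x assume x: "x \<in> carrier (dic_model n)"
  then show "\<one>\<^bsub>dic_model n\<^esub> \<otimes>\<^bsub>dic_model n\<^esub> x = x"
    by (auto simp: dic_model_def)
  obtain i e where [simp]: "x = (i, e)" by fastforce
  let ?y = "(if e then (i + int n) mod (2 * int n) else (- i) mod (2 * int n), e)"
  have "?y \<in> carrier (dic_model n)"
    using assms by (auto simp: dic_model_def)
  moreover have "?y \<otimes>\<^bsub>dic_model n\<^esub> x = \<one>\<^bsub>dic_model n\<^esub>"
    by (cases e; simp add: dic_model_def mod_simps)
      (simp add: mod_eq_0_iff_dvd minus_mult_div_eq_mod [symmetric] right_diff_distrib)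
  ultimately show "\<exists>y \<in> carrier (dic_model n). y \<otimes>\<^bsub>dic_model n\<^esub> x = \<one>\<^bsub>dic_model n\<^esub>"
    by blast
qed

lemma dicyclic_dic_model:
  assumes n: "n > 0"
  shows "dicyclic (dic_model n) n (1 mod (2 * int n), False) (0, True)"
proof -
  define G where "G = dic_model n"
  define a :: "int \<times> bool" where "a = (1 mod (2 * int n), False)"
  define b :: "int \<times> bool" where "b = (0, True)"
  interpret group G using dic_model_group[OF n] by (simp add: G_def)
  have a_in: "a \<in> carrier G" and b_in: "b \<in> carrier G"
    using n by (auto simp: G_def dic_model_def a_def b_def)
  have one: "\<one>\<^bsub>G\<^esub> = (0, False)" by (simp add: G_def dic_model_def)
  have pow: "a [^]\<^bsub>G\<^esub> k = (int k mod (2 * int n), False)" for k :: nat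
  proof (induction k)
    case 0
    then show ?case by (simp add: one)
  next
    case (Suc k)
    then show ?case by (simp add: a_def) (simp add: G_def dic_model_def mod_simps add.commute)
  qed
  have pow_a: "a [^]\<^bsub>G\<^esub> (2 * n) = \<one>\<^bsub>G\<^esub>" by (simp add: pow one)
  have bb: "b \<otimes>\<^bsub>G\<^esub> b = (int n, False)"
    using n by (simp add: G_def dic_model_def b_def)
  have rel: "a [^]\<^bsub>G\<^esub> n = b [^]\<^bsub>G\<^esub> (2 :: nat)"
    using n b_in by (simp add: pow bb numeral_2_eq_2)
  have aba: "(a \<otimes>\<^bsub>G\<^esub> b) \<otimes>\<^bsub>G\<^esub> a = b"
    by (simp add: G_def dic_model_def a_def b_def mod_simps)
  have conj: "inv\<^bsub>G\<^esub> b \<otimes>\<^bsub>G\<^esub> a \<otimes>\<^bsub>G\<^esub> b = inv\<^bsub>G\<^esub> a"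
  proof (rule inv_equality[symmetric])
    have "(inv\<^bsub>G\<^esub> b \<otimes>\<^bsub>G\<^esub> a \<otimes>\<^bsub>G\<^esub> b) \<otimes>\<^bsub>G\<^esub> a = inv\<^bsub>G\<^esub> b \<otimes>\<^bsub>G\<^esub> ((a \<otimes>\<^bsub>G\<^esub> b) \<otimes>\<^bsub>G\<^esub> a)"
      using a_in b_in by (simp add: m_assoc)
    then show "(inv\<^bsub>G\<^esub> b \<otimes>\<^bsub>G\<^esub> a \<otimes>\<^bsub>G\<^esub> b) \<otimes>\<^bsub>G\<^esub> a = \<one>\<^bsub>G\<^esub>"
      using b_in by (simp add: aba)
  qed (use a_in b_in in auto)
  have gen: "generate G {a, b} = carrier G"
  proof
    show "generate G {a, b} \<subseteq> carrier G"
      using a_in b_in by (intro generate_incl) auto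
    show "carrier G \<subseteq> generate G {a, b}"
    proof
      fix x assume x: "x \<in> carrier G"
      then obtain i e where ie: "x = (i, e)" "0 \<le> i" "i < 2 * int n"
        by (auto simp: G_def dic_model_def)
      have gp: "a [^]\<^bsub>G\<^esub> k \<in> generate G {a, b}" for k :: nat
        by (induction k) (auto intro: generate.intros)
      have "a [^]\<^bsub>G\<^esub> nat i = (i, False)" using ie by (simp add: pow)
      then have F: "(i, False) \<in> generate G {a, b}"
        using gp[of "nat i"] by simp
      have "(i, False) \<otimes>\<^bsub>G\<^esub> b = (i, True)"
        using ie by (simp add: G_def dic_model_def b_def)
      moreover have "b \<in> generate G {a, b}" by (auto intro: generate.intros)
      ultimately have "(i, True) \<in> generate G {a, b}"
        using generate.eng[OF F, of b] by simp
      with F show "x \<in> generate G {a, b}"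
        using ie by (cases e) auto
    qed
  qed
  have ord: "order G = 4 * n"
    by (simp add: order_def G_def dic_model_def card_cartesian_product card_UNIV_bool)
  have "dicyclic G n a b"
    by unfold_locales (use n a_in b_in gen ord pow_a rel conj in auto)
  then show ?thesis by (simp add: G_def a_def b_def)
qed

end

theory Submission
  imports Defs
begin

text \<open>
  Write \<open>A = R \<union> Sb\<close> with \<open>R\<close> the powers of \<open>a\<close> with exponents \<open>r, ..., r + n - 1\<close>, and let
  \<open>T\<close> be the set of exponents of \<open>S\<close>, a set of \<open>n\<close> residues modulo \<open>2n\<close>.  Writing exponents
  additively, with \<open>I = {r, ..., r + n - 1}\<close>, the relations give
  \<^item> in \<open>A + A\<close> the exponents \<open>(I + I) \<union> (T - T + n)\<close> on powers of \<open>a\<close> and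
    \<open>(I + T) \<union> (T - I)\<close> on elements \<open>a\<^sup>i b\<close>;
  \<^item> in \<open>A - A\<close> the exponents \<open>(I - I) \<union> (T - T)\<close> on powers of \<open>a\<close> and
    \<open>(I + T) \<union> (I + T + n)\<close> on elements \<open>a\<^sup>i b\<close>.

  Since \<open>I + I\<close> is everything but \<open>2r - 1\<close>, since \<open>I - I\<close> is everything but \<open>n\<close>, and since
  \<open>I \<union> (I + n)\<close> is everything, almost nothing can be missing.  The difference set misses exactly
  one element if \<open>n\<close> is not a difference of two elements of \<open>T\<close>, and none otherwise
  (\<open>card_diff_set\<close>).  The sum set misses one power of \<open>a\<close> if \<open>d = 2r - 1 - n\<close> is not such a
  difference, and none otherwise (\<open>card_sum_set\<close>).  It can miss an element \<open>a\<^sup>i b\<close> only if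
  \<open>T\<close> is an interval and \<open>2n\<close> divides \<open>d\<close>; then it misses just one, and the difference set
  misses one as well (\<open>card_diff_le_sum\<close>).

  Hence everything depends on which of the two numbers \<open>n\<close> and \<open>d\<close> the set \<open>T\<close> avoids as
  a difference.  If \<open>T\<close> avoids \<open>e\<close>, then \<open>T + e\<close> is the complement of \<open>T\<close>, because both have
  half the size of the group of residues (\<open>avoids_complement\<close>).  Iterating this \<open>n\<close> times has
  two consequences.  For odd \<open>n\<close> the number \<open>d\<close> is even, \<open>n d\<close> vanishes modulo \<open>2n\<close>, and \<open>T\<close>
  would equal its complement; so \<open>d\<close> is never avoided and no set of the family is MDTS.  For even
  \<open>n\<close> the number \<open>d\<close> is odd, \<open>n d\<close> is \<open>n\<close> modulo \<open>2n\<close>, and \<open>T + n = T\<close>; so avoiding \<open>d\<close>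
  excludes avoiding \<open>n\<close>.  Thus, for even \<open>n\<close>, a set is MSTD iff \<open>T\<close> avoids \<open>n\<close> and MDTS iff
  \<open>T\<close> avoids \<open>d\<close>; for odd \<open>n\<close> it is MSTD iff \<open>T\<close> avoids \<open>n\<close>, except possibly for the one
  value of \<open>r\<close> with \<open>d = 0\<close>.

  It remains to count.  Exactly \<open>2\<^sup>n\<close> sets \<open>T\<close> avoid \<open>n\<close>: one picks an element from each pair
  \<open>{x, x + n}\<close>.  An odd \<open>d\<close> is avoided by at least two sets, the even and the odd residues, and by
  at most \<open>2\<^sup>n\<close> sets, since \<open>T\<close> is determined by its even elements.  The family has
  \<open>(n + 1) (2n choose n)\<close> members, so the balanced sets are counted by subtraction; the bound claimed
  for them then follows from the hockey-stick identity.
\<close>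

section \<open>Half-sized subsets of the integers modulo 2n\<close>

definition half_sets :: "nat \<Rightarrow> int set set" where
  "half_sets n = {T. T \<subseteq> {0..<2 * int n} \<and> card T = n}"

text \<open>Equivalently, \<open>d\<close> is not a difference of two elements of \<open>T\<close> modulo \<open>2n\<close>.  The condition
  runs over all integers \<open>j\<close>, here as well as below, so that exponents of \<open>a\<close> can be shifted without
  being reduced first.\<close>

definition avoids :: "nat \<Rightarrow> int \<Rightarrow> int set \<Rightarrow> bool" where
  "avoids n d T \<longleftrightarrow> (\<forall>j. j mod (2 * int n) \<in> T \<longrightarrow> (j + d) mod (2 * int n) \<notin> T)"

lemma mod_add_half:
  assumes "n > 0"
  shows "(x + int n) mod (2 * int n) =
    (if x mod (2 * int n) < int n then x mod (2 * int n) + int n else x mod (2 * int n) - int n)"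
proof -
  define y where "y = x mod (2 * int n)"
  have y: "0 \<le> y" "y < 2 * int n" using assms by (auto simp: y_def)
  have "(x + int n) mod (2 * int n) = (y + int n) mod (2 * int n)"
    by (simp add: y_def mod_simps)
  also have "\<dots> = (if y < int n then y + int n else y - int n)"
    using y mod_add_self2[of "y - int n" "2 * int n"] by (auto simp: algebra_simps)
  finally show ?thesis by (simp add: y_def)
qed

lemma finite_half_sets: "finite (half_sets n)"
  by (rule finite_subset[of _ "Pow {0..<2 * int n}"]) (auto simp: half_sets_def)

lemma card_half_sets: "card (half_sets n) = (2 * n) choose n"
  using n_subsets[of "{0..<2 * int n}" n] by (simp add: half_sets_def nat_mult_distrib)

lemma bij_betw_add_mod:
  fixes N :: int
  assumes "N > 0"
  shows "bij_betw (\<lambda>x. (x + d) mod N) {0..<N} {0..<N}"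
proof (rule bij_betw_byWitness[where f' = "\<lambda>x. (x - d) mod N"])
  show "\<forall>x\<in>{0..<N}. ((x + d) mod N - d) mod N = x"
    by (simp add: mod_simps)
  show "\<forall>x\<in>{0..<N}. ((x - d) mod N + d) mod N = x"
    by (simp add: mod_simps)
qed (use assms in auto)

text \<open>The translate \<open>T + d\<close> is disjoint from \<open>T\<close> and has \<open>n\<close> elements as well, so the two sets
  exhaust the \<open>2n\<close> residues.\<close>

lemma avoids_complement:
  assumes n: "n > 0" and T: "T \<in> half_sets n" and av: "avoids n d T"
  shows "(x + d) mod (2 * int n) \<in> T \<longleftrightarrow> x mod (2 * int n) \<notin> T"
proof -
  define N where "N = 2 * int n"
  define f where "f = (\<lambda>x. (x + d) mod N)"
  have N: "N > 0" using n by (simp add: N_def)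
  have bij: "bij_betw f {0..<N} {0..<N}"
    unfolding f_def by (rule bij_betw_add_mod[OF N])
  have sub: "T \<subseteq> {0..<N}" and card: "card T = n"
    using T by (auto simp: half_sets_def N_def)
  have fin: "finite T" using sub finite_subset by blast
  have dis: "f ` T \<inter> T = {}"
  proof -
    have "f t \<notin> T" if "t \<in> T" for t
    proof -
      have "t mod N = t" using that sub by auto
      then show ?thesis using av that by (auto simp: avoids_def f_def N_def)
    qed
    then show ?thesis by auto
  qed
  have "card (f ` T) = n"
    using card card_image[OF inj_on_subset[OF bij_betw_imp_inj_on[OF bij] sub]] by simp
  then have "card (f ` T \<union> T) = 2 * n"
    using dis fin card by (subst card_Un_disjoint) auto
  moreover have "f ` T \<union> T \<subseteq> {0..<N}"
    using sub bij bij_betw_imp_surj_on by blast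
  ultimately have un: "f ` T \<union> T = {0..<N}"
    by (intro card_subset_eq) (auto simp: N_def nat_mult_distrib)
  define y where "y = x mod N"
  have y: "y \<in> {0..<N}" using N by (simp add: y_def)
  have fy: "f y = (x + d) mod N" by (simp add: f_def y_def mod_simps)
  have "f y \<in> T \<longleftrightarrow> y \<notin> T"
  proof
    assume "f y \<in> T"
    then show "y \<notin> T" using dis by blast
  next
    assume "y \<notin> T"
    then have "f y \<notin> f ` T"
      using y sub bij_betw_imp_inj_on[OF bij] by (meson inj_on_image_mem_iff)
    moreover have "f y \<in> {0..<N}" using bij y bij_betw_apply by fast
    ultimately show "f y \<in> T" using un by blast
  qed
  then show ?thesis unfolding fy unfolding y_def N_def .
qed

lemma avoids_iterate:
  assumes n: "n > 0" and T: "T \<in> half_sets n" and av: "avoids n d T"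
  shows "(x + int k * d) mod (2 * int n) \<in> T \<longleftrightarrow> (x mod (2 * int n) \<in> T \<longleftrightarrow> even k)"
proof (induction k)
  case (Suc k)
  have "x + int (Suc k) * d = (x + int k * d) + d" by (simp add: algebra_simps)
  then have "(x + int (Suc k) * d) mod (2 * int n) \<in> T \<longleftrightarrow> (x + int k * d) mod (2 * int n) \<notin> T"
    using avoids_complement[OF assms, of "x + int k * d"] by (simp only:)
  then show ?case using Suc by auto
qed simp

text \<open>After \<open>n\<close> steps of length \<open>d\<close> one is back at the start, but an odd number of steps swaps \<open>T\<close>
  and its complement.\<close>

lemma not_avoids_even:
  assumes n: "odd n" and T: "T \<in> half_sets n" and d: "even d"
  shows "\<not> avoids n d T"
proof
  assume av: "avoids n d T"
  have "n > 0" using n by (rule odd_pos)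
  obtain e where e: "d = 2 * e" using d by blast
  have "(0 + int n * d) mod (2 * int n) = 0" by (simp add: e)
  then show False using avoids_iterate[OF \<open>n > 0\<close> T av, of 0 n] n by auto
qed

text \<open>For odd \<open>d\<close>, \<open>n\<close> steps of length \<open>d\<close> lead from \<open>x\<close> to \<open>x + n\<close>, and an even number of steps
  preserves membership in \<open>T\<close>; avoiding \<open>n\<close> would reverse it.\<close>

lemma not_avoids_half_period:
  assumes n: "n > 0" "even n" and T: "T \<in> half_sets n" and d: "odd d" and av: "avoids n d T"
  shows "\<not> avoids n (int n) T"
proof
  assume "avoids n (int n) T"
  from avoids_complement[OF n(1) T this, of 0]
  have 1: "int n mod (2 * int n) \<in> T \<longleftrightarrow> 0 \<notin> T" by simp
  obtain e where e: "d = 2 * e + 1" using d by (rule oddE)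
  have "(0 + int n * d) mod (2 * int n) = int n mod (2 * int n)"
  proof -
    have "0 + int n * d = int n + e * (2 * int n)" by (simp add: e algebra_simps)
    then show ?thesis by (metis mod_mult_self1)
  qed
  then have 2: "int n mod (2 * int n) \<in> T \<longleftrightarrow> 0 \<in> T"
    using avoids_iterate[OF n(1) T av, of 0 n] n(2) unfolding \<open>(0 + int n * d) mod _ = _\<close> by simp
  from 1 2 show False by blast
qed

lemma not_avoids_zero:
  assumes n: "n > 0" and T: "T \<in> half_sets n" and d: "2 * int n dvd d"
  shows "\<not> avoids n d T"
proof
  assume "avoids n d T"
  moreover have "(0 + d) mod (2 * int n) = 0" using d by simp
  ultimately show False using avoids_complement[OF n T, of d 0] by simp
qed

lemma avoids_uminus: "avoids n (- d) T \<longleftrightarrow> avoids n d T"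
proof -
  have "avoids n (- e) T" if "avoids n e T" for e
    unfolding avoids_def
  proof (intro allI impI notI)
    fix j assume "j mod (2 * int n) \<in> T" and "(j + - e) mod (2 * int n) \<in> T"
    then show False using that[unfolded avoids_def, rule_format, of "j + - e"] by simp
  qed
  from this[of d] this[of "- d"] show ?thesis by auto
qed

lemma avoids_diff_iff:
  "(\<exists>j. j mod (2 * int n) \<in> T \<and> (j - d) mod (2 * int n) \<in> T) \<longleftrightarrow> \<not> avoids n d T"
  using avoids_uminus[of n d T] by (auto simp: avoids_def)

text \<open>By \<open>avoids_complement\<close>, \<open>T\<close> is determined by its intersection with any set \<open>D\<close> that
  together with its translate by \<open>d\<close> covers all residues.\<close>

lemma card_avoids_le:
  assumes n: "n > 0" and fin: "finite D"
    and cover: "\<And>x. x \<in> {0..<2 * int n} \<Longrightarrow> x \<in> D \<or> (\<exists>y\<in>D. y \<in> {0..<2 * int n} \<and> x = (y + d) mod (2 * int n))"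
  shows "card {T \<in> half_sets n. avoids n d T} \<le> 2 ^ card D"
proof -
  define M where "M = {T \<in> half_sets n. avoids n d T}"
  have *: "T \<subseteq> T'" if T: "T \<in> M" "T' \<in> M" and eq: "T \<inter> D = T' \<inter> D" for T T'
  proof
    fix x assume x: "x \<in> T"
    then have xN: "x \<in> {0..<2 * int n}" using T by (auto simp: M_def half_sets_def)
    from cover[OF xN] show "x \<in> T'"
    proof
      assume "x \<in> D"
      then show ?thesis using x eq by blast
    next
      assume "\<exists>y\<in>D. y \<in> {0..<2 * int n} \<and> x = (y + d) mod (2 * int n)"
      then obtain y where y: "y \<in> D" "y mod (2 * int n) = y" "x = (y + d) mod (2 * int n)"
        by auto
      have "y \<notin> T" using avoids_complement[OF n, of T d y] T x y by (auto simp: M_def)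
      then have "y \<notin> T'" using y eq by blast
      then show ?thesis using avoids_complement[OF n, of T' d y] T y by (auto simp: M_def)
    qed
  qed
  have "inj_on (\<lambda>T. T \<inter> D) M"
  proof (rule inj_onI)
    fix T T' assume "T \<in> M" "T' \<in> M" "T \<inter> D = T' \<inter> D"
    then show "T = T'" using *[of T T'] *[of T' T] by auto
  qed
  then have "card M \<le> card (Pow D)"
    by (rule card_inj_on_le) (use fin in auto)
  then show ?thesis using fin by (simp add: M_def card_Pow)
qed

lemma card_even_residues: "card {x \<in> {0..<2 * int n}. even x} = n"
proof -
  have "{x \<in> {0..<2 * int n}. even x} = (\<lambda>k. 2 * k) ` {0..<int n}"
    by (auto simp: image_iff elim!: evenE)
  moreover have "inj_on (\<lambda>k::int. 2 * k) {0..<int n}" by (auto intro: inj_onI)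
  ultimately show ?thesis by (simp add: card_image)
qed

lemma card_odd_residues: "card {x \<in> {0..<2 * int n}. odd x} = n"
proof -
  have "{x \<in> {0..<2 * int n}. odd x} = (\<lambda>k. 2 * k + 1) ` {0..<int n}"
    by (auto simp: image_iff elim!: oddE)
  moreover have "inj_on (\<lambda>k::int. 2 * k + 1) {0..<int n}" by (auto intro: inj_onI)
  ultimately show ?thesis by (simp add: card_image)
qed

text \<open>Translation by an odd \<open>d\<close> maps the even residues onto the odd ones.\<close>

lemma card_avoids_odd_le:
  assumes n: "n > 0" and d: "odd d"
  shows "card {T \<in> half_sets n. avoids n d T} \<le> 2 ^ n"
proof -
  let ?D = "{x \<in> {0..<2 * int n}. even x}"
  have "card {T \<in> half_sets n. avoids n d T} \<le> 2 ^ card ?D"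
  proof (rule card_avoids_le[OF n])
    fix x assume x: "x \<in> {0..<2 * int n}"
    show "x \<in> ?D \<or> (\<exists>y\<in>?D. y \<in> {0..<2 * int n} \<and> x = (y + d) mod (2 * int n))"
    proof (cases "even x")
      case False
      then have "even ((x - d) mod (2 * int n))" using d by (simp add: dvd_mod_iff)
      moreover have "((x - d) mod (2 * int n) + d) mod (2 * int n) = x"
        using x by (simp add: mod_simps)
      moreover have "(x - d) mod (2 * int n) \<in> {0..<2 * int n}" using n by simp
      ultimately show ?thesis by (metis (mono_tags, lifting) mem_Collect_eq)
    qed (use x in simp)
  qed (rule finite_subset[of _ "{0..<2 * int n}"], auto)
  then show ?thesis unfolding card_even_residues .
qed

lemma card_avoids_odd_ge:
  assumes n: "n > 0" and d: "odd d"
  shows "2 \<le> card {T \<in> half_sets n. avoids n d T}"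
proof -
  let ?E = "{x \<in> {0..<2 * int n}. even x}" and ?O = "{x \<in> {0..<2 * int n}. odd x}"
  have "?E \<in> half_sets n" "?O \<in> half_sets n"
    unfolding half_sets_def using card_even_residues[of n] card_odd_residues[of n] by blast+
  moreover have "avoids n d ?E" "avoids n d ?O"
    using d by (auto simp: avoids_def dvd_mod_iff)
  ultimately have "{?E, ?O} \<subseteq> {T \<in> half_sets n. avoids n d T}" by blast
  moreover have "?E \<noteq> ?O"
  proof -
    have "0 \<in> ?E" "0 \<notin> ?O" using n by auto
    then show ?thesis by metis
  qed
  ultimately show ?thesis
    using card_mono[of "{T \<in> half_sets n. avoids n d T}" "{?E, ?O}"] finite_half_sets[of n] by simp
qed

lemma card_avoids_half_period:
  assumes n: "n > 0"
  shows "card {T \<in> half_sets n. avoids n (int n) T} = 2 ^ n"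
proof (rule antisym)
  let ?D = "{0..<int n}"
  have "card {T \<in> half_sets n. avoids n (int n) T} \<le> 2 ^ card ?D"
  proof (rule card_avoids_le[OF n])
    fix x assume x: "x \<in> {0..<2 * int n}"
    show "x \<in> ?D \<or> (\<exists>y\<in>?D. y \<in> {0..<2 * int n} \<and> x = (y + int n) mod (2 * int n))"
    proof (cases "x < int n")
      case False
      then show ?thesis using x by (intro disjI2 bexI[of _ "x - int n"]) auto
    qed (use x in simp)
  qed simp
  then show "card {T \<in> half_sets n. avoids n (int n) T} \<le> 2 ^ n" by simp
next
  let ?D = "{0..<int n}"
  \<comment> \<open>A subset \<open>U\<close> of the lower half extends to a set that meets each pair \<open>{x, x + n}\<close> once.\<close>
  define F where "F = (\<lambda>U. U \<union> (\<lambda>x. x + int n) ` (?D - U))"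
  have "F U \<in> {T \<in> half_sets n. avoids n (int n) T}" if U: "U \<subseteq> ?D" for U
  proof -
    have fin: "finite U" using U finite_subset by blast
    have inj: "inj_on (\<lambda>x. x + int n) (?D - U)" by (auto intro: inj_onI)
    have "card (F U) = card U + card (?D - U)"
      unfolding F_def using U fin by (subst card_Un_disjoint) (auto simp: card_image[OF inj])
    also have "\<dots> = n"
      using U fin card_mono[OF _ U] by (simp add: card_Diff_subset)
    finally have "F U \<in> half_sets n" using U by (auto simp: half_sets_def F_def)
    moreover have "avoids n (int n) (F U)"
      unfolding avoids_def
    proof (intro allI impI)
      fix j assume j: "j mod (2 * int n) \<in> F U"
      define y where "y = j mod (2 * int n)"
      have y: "0 \<le> y" "y < 2 * int n" using n by (auto simp: y_def)
      have yn: "(j + int n) mod (2 * int n) = (if y < int n then y + int n else y - int n)"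
        unfolding y_def by (rule mod_add_half[OF n])
      have "y \<in> F U" using j by (simp add: y_def)
      then show "(j + int n) mod (2 * int n) \<notin> F U"
        unfolding yn using U y by (auto simp: F_def)
    qed
    ultimately show ?thesis by simp
  qed
  moreover have "inj_on F (Pow ?D)"
  proof (rule inj_on_inverseI)
    fix U assume "U \<in> Pow ?D"
    then show "F U \<inter> ?D = U" by (auto simp: F_def)
  qed
  ultimately have "card (Pow ?D) \<le> card {T \<in> half_sets n. avoids n (int n) T}"
    by (intro card_inj_on_le[of F]) (auto simp: finite_half_sets)
  then show "2 ^ n \<le> card {T \<in> half_sets n. avoids n (int n) T}"
    by (simp add: card_Pow)
qed

section \<open>Intervals of length n modulo 2n\<close>

lemma mod_double_shift:
  assumes "n > 0"
  shows "(x + int n) mod (2 * int n) < int n \<longleftrightarrow> \<not> x mod (2 * int n) < int n"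
proof -
  obtain y where y: "x mod (2 * int n) = y" "0 \<le> y" "y < 2 * int n" using assms by simp
  then show ?thesis by (auto simp: mod_add_half[OF assms])
qed

text \<open>The reflection \<open>y \<mapsto> 2n - 1 - y\<close> swaps the two halves of the residues, just as the translation
  by \<open>n\<close> does.\<close>

lemma mod_double_reflect:
  assumes "n > 0"
  shows "(- x - 1) mod (2 * int n) < int n \<longleftrightarrow> \<not> x mod (2 * int n) < int n"
proof -
  define y where "y = x mod (2 * int n)"
  have y: "0 \<le> y" "y < 2 * int n" using assms by (auto simp: y_def)
  have "(- x - 1) mod (2 * int n) = (- y - 1) mod (2 * int n)"
    unfolding y_def by (intro mod_diff_cong mod_minus_cong) simp_all
  also have "\<dots> = (2 * int n - 1 - y) mod (2 * int n)"
    using mod_add_self2[of "- y - 1" "2 * int n"] by (simp add: algebra_simps)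
  also have "\<dots> = 2 * int n - 1 - y" using y by simp
  finally show ?thesis using y by (auto simp: y_def[symmetric])
qed

text \<open>The starting points \<open>c\<close> and \<open>c'\<close> lie in each other's interval, at distances that add up to
  \<open>0\<close> or \<open>2n\<close>; since both distances are less than \<open>n\<close>, they vanish.\<close>

lemma interval_start_unique:
  assumes n: "n > 0"
    and eq: "\<And>k. (k - c) mod (2 * int n) < int n \<longleftrightarrow> (k - c') mod (2 * int n) < int n"
  shows "2 * int n dvd c - c'"
proof (rule ccontr)
  assume nd: "\<not> 2 * int n dvd c - c'"
  have 1: "(c - c') mod (2 * int n) < int n" using eq[of c] n by simp
  have "(c' - c) mod (2 * int n) < int n" using eq[of c'] n by simp
  moreover have "(c' - c) mod (2 * int n) = 2 * int n - (c - c') mod (2 * int n)"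
    using nd by (metis minus_diff_eq zmod_zminus1_eq_if dvd_eq_mod_eq_0)
  ultimately show False using 1 by linarith
qed

lemma half_set_eq_interval:
  assumes n: "n > 0" and T: "T \<in> half_sets n"
    and sub: "\<And>k. k mod (2 * int n) \<in> T \<Longrightarrow> (k - c) mod (2 * int n) < int n"
  shows "k mod (2 * int n) \<in> T \<longleftrightarrow> (k - c) mod (2 * int n) < int n"
proof -
  define f where "f = (\<lambda>x. (x + (- c)) mod (2 * int n))"
  have N: "2 * int n > 0" using n by simp
  have bij: "bij_betw f {0..<2 * int n} {0..<2 * int n}"
    unfolding f_def by (rule bij_betw_add_mod[OF N])
  have TN: "T \<subseteq> {0..<2 * int n}" and card: "card T = n" using T by (auto simp: half_sets_def)
  have inj: "inj_on f {0..<2 * int n}" using bij by (rule bij_betw_imp_inj_on)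
  have "f t \<in> {0..<int n}" if t: "t \<in> T" for t
  proof -
    have "t mod (2 * int n) = t" using t TN by auto
    then show ?thesis using sub[of t] t N by (simp add: f_def)
  qed
  then have "f ` T \<subseteq> {0..<int n}" by blast
  moreover have "card (f ` T) = card {0..<int n}"
    using card card_image[OF inj_on_subset[OF inj TN]] by simp
  ultimately have fT: "f ` T = {0..<int n}" by (intro card_subset_eq) auto
  define y where "y = k mod (2 * int n)"
  have y: "y \<in> {0..<2 * int n}" using N by (simp add: y_def)
  have "f y = (k - c) mod (2 * int n)" by (simp add: f_def y_def mod_simps)
  moreover have "y \<in> T \<longleftrightarrow> f y \<in> f ` T"
    using inj TN y by (meson inj_on_image_mem_iff)
  moreover have "0 \<le> f y" using N by (simp add: f_def)
  ultimately show ?thesis by (simp add: fT y_def)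
qed

lemma interval_avoids:
  assumes n: "n > 0"
    and T: "\<And>k. k mod (2 * int n) \<in> T \<longleftrightarrow> (k - c) mod (2 * int n) < int n"
  shows "avoids n (int n) T"
  unfolding avoids_def
proof (intro allI impI)
  fix j assume "j mod (2 * int n) \<in> T"
  then show "(j + int n) mod (2 * int n) \<notin> T"
    unfolding T using mod_double_shift[OF n, of "j - c"] by (simp add: algebra_simps)
qed

text \<open>Modulo \<open>2n\<close>, an interval of length \<open>n\<close> starting at \<open>r\<close> has as its sumset
  \<open>{2r, ..., 2r + 2n - 2}\<close>, which omits only \<open>2r - 1\<close>.\<close>

lemma interval_sum_iff:
  assumes n: "n > 0"
  shows "(\<exists>j. (j - r) mod (2 * int n) < int n \<and> (i - j - r) mod (2 * int n) < int n)
    \<longleftrightarrow> \<not> 2 * int n dvd i - (2 * r - 1)"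
proof
  assume "\<exists>j. (j - r) mod (2 * int n) < int n \<and> (i - j - r) mod (2 * int n) < int n"
  then obtain j where j: "(j - r) mod (2 * int n) < int n" "(i - j - r) mod (2 * int n) < int n"
    by blast
  show "\<not> 2 * int n dvd i - (2 * r - 1)"
  proof
    assume "2 * int n dvd i - (2 * r - 1)"
    then have "(i - j - r) mod (2 * int n) = (- (j - r) - 1) mod (2 * int n)"
      by (simp add: mod_eq_dvd_iff algebra_simps)
    then show False using mod_double_reflect[OF n, of "j - r"] j by simp
  qed
next
  assume nd: "\<not> 2 * int n dvd i - (2 * r - 1)"
  define e where "e = (i - 2 * r) mod (2 * int n)"
  have N: "2 * int n > 0" using n by simp
  have e0: "0 \<le> e" "e < 2 * int n" using N by (auto simp: e_def)
  have "e \<noteq> 2 * int n - 1"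
  proof
    assume "e = 2 * int n - 1"
    then have "(i - 2 * r) mod (2 * int n) = (- 1) mod (2 * int n)"
      using n by (simp add: e_def zmod_minus1)
    then show False using nd by (simp add: mod_eq_dvd_iff algebra_simps)
  qed
  then have e1: "e \<le> 2 * int n - 2" using e0 by simp
  \<comment> \<open>Split the offset \<open>e \<le> 2n - 2\<close> greedily into two offsets below \<open>n\<close>.\<close>
  define u where "u = min e (int n - 1)"
  have u: "0 \<le> u" "u < int n" "0 \<le> e - u" "e - u < int n"
    using e0 e1 n by (auto simp: u_def)
  have "(r + u - r) mod (2 * int n) < int n" using u by simp
  moreover have "(i - (r + u) - r) mod (2 * int n) = (e - u) mod (2 * int n)"
    by (simp add: e_def mod_simps algebra_simps)
  ultimately show "\<exists>j. (j - r) mod (2 * int n) < int n \<and> (i - j - r) mod (2 * int n) < int n"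
    using u by (intro exI[of _ "r + u"]) simp
qed

text \<open>The negative of an interval is an interval, so this is \<open>interval_sum_iff\<close> after a shift.\<close>

lemma interval_diff_iff:
  assumes n: "n > 0"
  shows "(\<exists>j. (j - r) mod (2 * int n) < int n \<and> (j - i - r) mod (2 * int n) < int n)
    \<longleftrightarrow> \<not> 2 * int n dvd i - int n"
proof -
  have refl: "(j - i - r) mod (2 * int n) < int n \<longleftrightarrow>
      ((i + 2 * r + int n - 1) - j - r) mod (2 * int n) < int n" for j
  proof -
    have eq: "(i + 2 * r + int n - 1) - j - r = (- (j - i - r) - 1) + int n"
      by simp
    show ?thesis
      unfolding eq mod_double_shift[OF n] mod_double_reflect[OF n] by simp
  qed
  have "2 * int n dvd (i + 2 * r + int n - 1) - (2 * r - 1) \<longleftrightarrow> 2 * int n dvd i - int n"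
  proof -
    have "(i + 2 * r + int n - 1) - (2 * r - 1) = (i - int n) + 2 * int n" by simp
    then show ?thesis by (simp only: dvd_add_left_iff dvd_refl)
  qed
  then show ?thesis using interval_sum_iff[OF n, of r "i + 2 * r + int n - 1"] refl by simp
qed

section \<open>The dicyclic group\<close>

context dicyclic
begin

abbreviation rot :: "int \<Rightarrow> 'a" where "rot i \<equiv> a [^] i"
abbreviation flip :: "int \<Rightarrow> 'a" where "flip i \<equiv> a [^] i \<otimes> b"

lemma rot_closed [simp]: "rot i \<in> carrier G" and flip_closed [simp]: "flip i \<in> carrier G"
  using a_carrier b_carrier by auto

lemma rot_mult: "rot i \<otimes> rot j = rot (i + j)"
  by (simp add: int_pow_mult a_carrier)

lemma inv_rot: "inv (rot i) = rot (- i)"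
  by (simp add: int_pow_neg a_carrier)

lemma rot_period: "rot (i + 2 * int n * k) = rot i"
proof -
  have "rot (2 * int n) = \<one>" using rel_a int_pow_int[of G a "2 * n"] by simp
  then have "rot (2 * int n * k) = \<one>"
    using int_pow_pow[OF a_carrier, of "2 * int n" k] by simp
  then show ?thesis using rot_mult[of i "2 * int n * k"] by simp
qed

lemma rot_cong: "2 * int n dvd i - j \<Longrightarrow> rot i = rot j"
  using rot_period[of j] by (elim dvdE) (simp add: algebra_simps)

lemma b_rot: "b \<otimes> rot i = rot (- i) \<otimes> b"
proof -
  have "a \<otimes> b = b \<otimes> inv a"
  proof -
    have "b \<otimes> inv a = b \<otimes> (inv b \<otimes> (a \<otimes> b))"
      using rel_conj a_carrier b_carrier by (simp add: m_assoc)
    also have "\<dots> = a \<otimes> b"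
      using a_carrier b_carrier by (simp add: m_assoc[symmetric])
    finally show ?thesis by simp
  qed
  then have ba: "b \<otimes> rot (- 1) = rot 1 \<otimes> b"
    using a_carrier by (simp add: int_pow_neg)
  have base: "b \<otimes> rot 1 = rot (- 1) \<otimes> b"
  proof -
    have "rot (- 1) \<otimes> b = rot (- 1) \<otimes> (b \<otimes> rot (- 1)) \<otimes> rot 1"
      using b_carrier by (simp add: m_assoc rot_mult del: int_pow_1)
    also have "\<dots> = b \<otimes> rot 1"
      using b_carrier by (simp add: ba m_assoc[symmetric] rot_mult del: int_pow_1)
    finally show ?thesis by simp
  qed
  have step: "b \<otimes> rot (i + e) = rot (- (i + e)) \<otimes> b"
    if "b \<otimes> rot i = rot (- i) \<otimes> b" "b \<otimes> rot e = rot (- e) \<otimes> b" for i e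
  proof -
    have "b \<otimes> rot (i + e) = b \<otimes> rot i \<otimes> rot e"
      using b_carrier by (simp add: m_assoc rot_mult)
    also have "\<dots> = rot (- i) \<otimes> rot (- e) \<otimes> b"
      using b_carrier that by (simp add: m_assoc)
    also have "\<dots> = rot (- (i + e)) \<otimes> b" by (simp add: rot_mult)
    finally show ?thesis .
  qed
  show ?thesis
  proof (induction i rule: int_induct[where k = 0])
    case base
    show ?case using b_carrier by simp
  next
    case (step1 i)
    from step[OF step1(2) base] show ?case .
  next
    case (step2 i)
    from step[OF step2(2), of "- 1"] ba show ?case by simp
  qed
qed

lemma b_square: "b \<otimes> b = rot (int n)"
  using rel_ab b_carrier by (simp add: numeral_2_eq_2 int_pow_int)

lemma rot_flip: "rot i \<otimes> flip j = flip (i + j)"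
  using b_carrier by (simp add: m_assoc[symmetric] rot_mult)

lemma flip_rot: "flip i \<otimes> rot j = flip (i - j)"
  using b_carrier by (simp add: m_assoc b_rot) (simp add: m_assoc[symmetric] rot_mult)

lemma flip_flip: "flip i \<otimes> flip j = rot (i - j + int n)"
proof -
  have "flip i \<otimes> flip j = flip i \<otimes> rot j \<otimes> b"
    using b_carrier by (simp add: m_assoc)
  also have "\<dots> = rot (i - j) \<otimes> (b \<otimes> b)"
    using b_carrier by (simp add: flip_rot) (simp add: m_assoc)
  finally show ?thesis by (simp add: b_square rot_mult)
qed

lemma inv_flip: "inv (flip i) = flip (i + int n)"
proof (rule inv_equality)
  have "rot (2 * int n) = rot 0" by (rule rot_cong) simp
  then show "flip (i + int n) \<otimes> flip i = \<one>" by (simp add: flip_flip)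
qed auto

lemma rot_mod: "rot (i mod (2 * int n)) = rot i"
  by (rule rot_cong) (simp add: mod_eq_dvd_iff[symmetric])

text \<open>The powers of \<open>a\<close> together with their products with \<open>b\<close> contain the generators and are closed
  under multiplication.\<close>

lemma carrier_eq: "carrier G = rot ` {0..<2 * int n} \<union> flip ` {0..<2 * int n}"
proof -
  have N: "2 * int n > 0" using n_pos by simp
  have "x \<in> range rot \<union> range flip" if "x \<in> generate G {a, b}" for x
    using that
  proof induction
    case one
    then show ?case using rangeI[of rot 0] by simp
  next
    case (incl h)
    then show ?case
      using rangeI[of rot 1] rangeI[of flip 0] a_carrier b_carrier by auto
  next
    case (inv h)
    then show ?case
      using rangeI[of rot "- 1"] rangeI[of flip "int n"] inv_rot[of 1] inv_flip[of 0]
        a_carrier b_carrier by auto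
  next
    case (eng h1 h2)
    then show ?case
      by (auto simp: rot_mult rot_flip flip_rot flip_flip)
  qed
  then have "carrier G \<subseteq> range rot \<union> range flip" using generated by auto
  also have "\<dots> \<subseteq> rot ` {0..<2 * int n} \<union> flip ` {0..<2 * int n}"
  proof -
    have "rot i \<in> rot ` {0..<2 * int n}" "flip i \<in> flip ` {0..<2 * int n}" for i
      using N by (auto intro!: image_eqI[of _ _ "i mod (2 * int n)"] simp: rot_mod)
    then show ?thesis by auto
  qed
  finally show ?thesis by auto
qed

text \<open>The \<open>4n\<close> expressions in \<open>carrier_eq\<close> exhaust a group of order \<open>4n\<close>, so they are pairwise
  distinct.\<close>

lemma inj_on_rot: "inj_on rot {0..<2 * int n}"
  and rot_neq_flip: "rot i \<noteq> flip j"
proof -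
  let ?I = "{0..<2 * int n}"
  have cI: "card ?I = 2 * n" by (simp add: nat_mult_distrib)
  have c: "card (rot ` ?I \<union> flip ` ?I) = 4 * n"
    using order_eq by (simp add: order_def carrier_eq)
  have c1: "card (rot ` ?I) \<le> 2 * n" using card_image_le[of ?I rot] cI by simp
  have c2: "card (flip ` ?I) \<le> 2 * n" using card_image_le[of ?I flip] cI by simp
  have c3: "card (rot ` ?I \<union> flip ` ?I) + card (rot ` ?I \<inter> flip ` ?I)
      = card (rot ` ?I) + card (flip ` ?I)"
    using card_Un_Int[of "rot ` ?I" "flip ` ?I"] by simp
  have "card (rot ` ?I) = card ?I" and dis: "card (rot ` ?I \<inter> flip ` ?I) = 0"
    using c c1 c2 c3 cI by linarith+
  then show "inj_on rot ?I" by (intro eq_card_imp_inj_on) auto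
  have dis: "rot ` ?I \<inter> flip ` ?I = {}" using dis by (simp add: card_eq_0_iff)
  have "rot i \<in> rot ` ?I" "flip j \<in> flip ` ?I"
    using n_pos by (auto intro!: image_eqI[of _ _ "_ mod (2 * int n)"] simp: rot_mod)
  then show "rot i \<noteq> flip j" using dis by (metis disjoint_iff)
qed

lemma rot_eq_iff: "rot i = rot j \<longleftrightarrow> i mod (2 * int n) = j mod (2 * int n)"
proof -
  have "i mod (2 * int n) \<in> {0..<2 * int n}" "j mod (2 * int n) \<in> {0..<2 * int n}"
    using n_pos by simp_all
  from inj_on_eq_iff[OF inj_on_rot this] show ?thesis unfolding rot_mod .
qed

lemma flip_eq_iff: "flip i = flip j \<longleftrightarrow> i mod (2 * int n) = j mod (2 * int n)"
  using b_carrier by (simp add: rot_eq_iff)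

lemma carrier_cases:
  assumes "x \<in> carrier G"
  obtains i where "x = rot i" | i where "x = flip i"
  using assms carrier_eq by auto

lemma sum_set_iff:
  assumes "A \<subseteq> carrier G" "x \<in> carrier G"
  shows "x \<in> sum_set G A \<longleftrightarrow> (\<exists>y\<in>A. inv y \<otimes> x \<in> A)"
proof
  assume "x \<in> sum_set G A"
  then obtain y z where yz: "y \<in> A" "z \<in> A" "x = y \<otimes> z"
    by (auto simp: sum_set_def set_mult_def)
  then have "y \<in> carrier G" "z \<in> carrier G" using assms by auto
  then have "inv y \<otimes> x = z" using yz by (simp add: m_assoc[symmetric])
  then show "\<exists>y\<in>A. inv y \<otimes> x \<in> A" using yz by blast
next
  assume "\<exists>y\<in>A. inv y \<otimes> x \<in> A"
  then obtain y where y: "y \<in> A" "inv y \<otimes> x \<in> A" by blast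
  then have "y \<otimes> (inv y \<otimes> x) = x" using assms by (auto simp: m_assoc[symmetric])
  then show "x \<in> sum_set G A"
    using y unfolding sum_set_def set_mult_def by force
qed

lemma diff_set_iff:
  assumes "A \<subseteq> carrier G" "x \<in> carrier G"
  shows "x \<in> diff_set G A \<longleftrightarrow> (\<exists>y\<in>A. inv x \<otimes> y \<in> A)"
proof
  assume "x \<in> diff_set G A"
  then obtain y z where yz: "y \<in> A" "z \<in> A" "x = y \<otimes> inv z"
    by (auto simp: diff_set_def set_mult_def SET_INV_def)
  then have "y \<in> carrier G" "z \<in> carrier G" using assms by auto
  then have "inv x \<otimes> y = z" using yz by (simp add: m_assoc inv_mult_group)
  then show "\<exists>y\<in>A. inv x \<otimes> y \<in> A" using yz by blast
next
  assume "\<exists>y\<in>A. inv x \<otimes> y \<in> A"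
  then obtain y where y: "y \<in> A" "inv x \<otimes> y \<in> A" by blast
  then have "x = y \<otimes> inv (inv x \<otimes> y)"
    using assms by (auto simp: m_assoc[symmetric] inv_mult_group)
  then show "x \<in> diff_set G A"
    using y unfolding diff_set_def set_mult_def SET_INV_def by blast
qed

section \<open>Which elements the sum set and the difference set miss\<close>

text \<open>The general set of the family, with \<open>T\<close> the set of exponents of \<open>S\<close>.  Letting the exponents
  range over all integers makes membership of \<open>a\<^sup>i\<close> and \<open>a\<^sup>i b\<close> a condition on \<open>i\<close> alone.\<close>

definition dic_set :: "int \<Rightarrow> int set \<Rightarrow> 'a set" where
  "dic_set r T = {rot i | i. (i - r) mod (2 * int n) < int n} \<union> {flip i | i. i mod (2 * int n) \<in> T}"

lemma dic_set_carrier: "dic_set r T \<subseteq> carrier G"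
  by (auto simp: dic_set_def)

lemma rot_mem_dic_set: "rot i \<in> dic_set r T \<longleftrightarrow> (i - r) mod (2 * int n) < int n"
proof
  assume "rot i \<in> dic_set r T"
  then obtain j where "rot i = rot j" and j: "(j - r) mod (2 * int n) < int n"
    using rot_neq_flip unfolding dic_set_def by blast
  then have "(i - r) mod (2 * int n) = (j - r) mod (2 * int n)"
    by (intro mod_diff_cong) (simp_all add: rot_eq_iff)
  then show "(i - r) mod (2 * int n) < int n" using j by simp
qed (auto simp: dic_set_def)

lemma flip_mem_dic_set: "flip i \<in> dic_set r T \<longleftrightarrow> i mod (2 * int n) \<in> T"
proof -
  have "flip i \<noteq> rot j" for j using rot_neq_flip[of j i] by simp
  then show ?thesis by (auto simp: dic_set_def flip_eq_iff)
qed

lemma Bex_dic_set: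
  "(\<exists>y\<in>dic_set r T. P y) \<longleftrightarrow>
    (\<exists>j. (j - r) mod (2 * int n) < int n \<and> P (rot j)) \<or> (\<exists>j. j mod (2 * int n) \<in> T \<and> P (flip j))"
  by (auto simp: dic_set_def)

lemma rot_sum_set:
  "rot i \<in> sum_set G (dic_set r T) \<longleftrightarrow>
    \<not> 2 * int n dvd i - (2 * r - 1) \<or> \<not> avoids n (i - int n) T"
proof -
  have "inv (flip j) \<otimes> rot i = flip (j - (i - int n))" for j
    by (simp add: inv_flip flip_rot algebra_simps)
  moreover have "inv (rot j) \<otimes> rot i = rot (i - j)" for j by (simp add: inv_rot rot_mult)
  ultimately show ?thesis
    by (simp add: sum_set_iff[OF dic_set_carrier] Bex_dic_set rot_mem_dic_set flip_mem_dic_set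
        interval_sum_iff[OF n_pos] avoids_diff_iff)
qed

lemma flip_sum_set:
  "flip i \<in> sum_set G (dic_set r T) \<longleftrightarrow>
    (\<exists>j. j mod (2 * int n) \<in> T \<and> (i - j - r) mod (2 * int n) < int n) \<or>
    (\<exists>j. j mod (2 * int n) \<in> T \<and> (j - i - r) mod (2 * int n) < int n)"
proof -
  have 1: "inv (flip j) \<otimes> flip i = rot (j - i)" for j
    using rot_period[of "j - i" 1] by (simp add: inv_flip flip_flip algebra_simps)
  have 2: "inv (rot j) \<otimes> flip i = flip (i - j)" for j
    by (simp add: inv_rot rot_flip)
  have "(\<exists>j. (j - r) mod (2 * int n) < int n \<and> (i - j) mod (2 * int n) \<in> T) \<longleftrightarrow>
      (\<exists>j. j mod (2 * int n) \<in> T \<and> (i - j - r) mod (2 * int n) < int n)"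
  proof (intro iffI; elim exE)
    fix j assume "(j - r) mod (2 * int n) < int n \<and> (i - j) mod (2 * int n) \<in> T"
    then show "\<exists>j. j mod (2 * int n) \<in> T \<and> (i - j - r) mod (2 * int n) < int n"
      by (intro exI[of _ "i - j"]) simp
  next
    fix j assume "j mod (2 * int n) \<in> T \<and> (i - j - r) mod (2 * int n) < int n"
    then show "\<exists>j. (j - r) mod (2 * int n) < int n \<and> (i - j) mod (2 * int n) \<in> T"
      by (intro exI[of _ "i - j"]) simp
  qed
  then show ?thesis
    by (simp add: sum_set_iff[OF dic_set_carrier] Bex_dic_set 1 2 rot_mem_dic_set flip_mem_dic_set)
qed

lemma rot_diff_set:
  "rot i \<in> diff_set G (dic_set r T) \<longleftrightarrow> \<not> 2 * int n dvd i - int n \<or> \<not> avoids n i T"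
proof -
  have 1: "inv (rot i) \<otimes> rot j = rot (j - i)" for j by (simp add: inv_rot rot_mult)
  have 2: "inv (rot i) \<otimes> flip j = flip (j - i)" for j
    by (simp add: inv_rot rot_flip)
  show ?thesis
    by (simp add: diff_set_iff[OF dic_set_carrier] Bex_dic_set 1 2 rot_mem_dic_set flip_mem_dic_set
        interval_diff_iff[OF n_pos] avoids_diff_iff)
qed

text \<open>For \<open>t \<in> T\<close>, one of \<open>i - t\<close> and \<open>i - t + n\<close> lies in the interval of exponents, as the interval
  and its translate by \<open>n\<close> cover all residues.\<close>

lemma flip_diff_set:
  assumes "T \<in> half_sets n"
  shows "flip i \<in> diff_set G (dic_set r T)"
proof -
  have ff: "inv (flip i) \<otimes> flip j = rot (i - j)" for j
    using rot_period[of "i - j" 1] by (simp add: inv_flip flip_flip algebra_simps)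
  have fr: "inv (flip i) \<otimes> rot j = flip (i + int n - j)" for j
    by (simp add: inv_flip flip_rot)
  have "T \<noteq> {}" "T \<subseteq> {0..<2 * int n}" using assms n_pos by (auto simp: half_sets_def)
  then obtain t where t: "t \<in> T" "t mod (2 * int n) = t" by force
  consider "(i - t - r) mod (2 * int n) < int n" | "(i + int n - t - r) mod (2 * int n) < int n"
    using mod_double_shift[OF n_pos, of "i - t - r"] by (auto simp: algebra_simps)
  then show ?thesis
  proof cases
    case 1
    then show ?thesis
      unfolding diff_set_iff[OF dic_set_carrier flip_closed] Bex_dic_set ff rot_mem_dic_set
      using t by (intro disjI2 exI[of _ t]) simp
  next
    case 2
    then show ?thesis
      unfolding diff_set_iff[OF dic_set_carrier flip_closed] Bex_dic_set fr flip_mem_dic_set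
      using t by (intro disjI1 exI[of _ "i + int n - t"]) simp
  qed
qed

lemma card_eq_missing:
  assumes "A \<subseteq> carrier G"
  shows "card A + card (carrier G - A) = 4 * n"
proof -
  have "finite (carrier G)" by (simp add: carrier_eq)
  then show ?thesis
    using assms order_eq card_mono[of "carrier G" A]
    by (simp add: order_def card_Diff_subset finite_subset)
qed

lemma sum_set_carrier: "sum_set G (dic_set r T) \<subseteq> carrier G"
  unfolding sum_set_def by (rule set_mult_closed) (rule dic_set_carrier)+

lemma diff_set_carrier: "diff_set G (dic_set r T) \<subseteq> carrier G"
  unfolding diff_set_def SET_INV_def using dic_set_carrier by (intro set_mult_closed) auto

lemma card_diff_set:
  assumes T: "T \<in> half_sets n"
  shows "card (diff_set G (dic_set r T)) = 4 * n - of_bool (avoids n (int n) T)"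
proof -
  let ?M = "carrier G - diff_set G (dic_set r T)"
  have "x = rot (int n)" if "x \<in> ?M" for x
  proof -
    from that have "x \<in> carrier G" by simp
    then show ?thesis
    proof (cases rule: carrier_cases)
      case (1 i)
      then show ?thesis using that rot_diff_set[of i r T] by (auto intro: rot_cong)
    next
      case (2 i)
      then show ?thesis using that flip_diff_set[OF T] by simp
    qed
  qed
  moreover have "rot (int n) \<in> ?M \<longleftrightarrow> avoids n (int n) T"
    by (simp add: rot_diff_set)
  ultimately have "?M = (if avoids n (int n) T then {rot (int n)} else {})" by auto
  then have "card ?M = of_bool (avoids n (int n) T)" by simp
  then show ?thesis using card_eq_missing[OF diff_set_carrier, of r T] by simp
qed

text \<open>If \<open>a\<^sup>i b\<close> is missing from the sum set, then \<open>T\<close> is disjoint from the \<open>n\<close>-intervals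
  \<open>i - I\<close> and \<open>i + I\<close>, where \<open>I\<close> is the interval of exponents starting at \<open>r\<close>.  Being of size
  \<open>n\<close>, it equals the complement of each, which is again an interval.\<close>

lemma missing_flip_interval:
  assumes T: "T \<in> half_sets n" and miss: "flip i \<notin> sum_set G (dic_set r T)"
  shows "k mod (2 * int n) \<in> T \<longleftrightarrow> (k - (i - r + 1)) mod (2 * int n) < int n"
    and "k mod (2 * int n) \<in> T \<longleftrightarrow> (k - (i + r + int n)) mod (2 * int n) < int n"
proof -
  have m: "\<not> (i - j - r) mod (2 * int n) < int n" "\<not> (j - i - r) mod (2 * int n) < int n"
    if "j mod (2 * int n) \<in> T" for j
    using miss that by (auto simp: flip_sum_set)
  show "k mod (2 * int n) \<in> T \<longleftrightarrow> (k - (i - r + 1)) mod (2 * int n) < int n"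
  proof (rule half_set_eq_interval[OF n_pos T])
    fix j assume "j mod (2 * int n) \<in> T"
    then show "(j - (i - r + 1)) mod (2 * int n) < int n"
      using mod_double_reflect[OF n_pos, of "i - j - r"] m(1)[of j] by (simp add: algebra_simps)
  qed
  show "k mod (2 * int n) \<in> T \<longleftrightarrow> (k - (i + r + int n)) mod (2 * int n) < int n"
  proof (rule half_set_eq_interval[OF n_pos T])
    fix j assume "j mod (2 * int n) \<in> T"
    then show "(j - (i + r + int n)) mod (2 * int n) < int n"
      using mod_double_shift[OF n_pos, of "j - (i + r + int n)"] m(2)[of j]
      by (simp add: algebra_simps)
  qed
qed

lemma missing_flip_unique:
  assumes T: "T \<in> half_sets n"
    and "flip i \<notin> sum_set G (dic_set r T)" "flip j \<notin> sum_set G (dic_set r T)"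
  shows "flip i = flip j"
proof -
  have "2 * int n dvd (i - r + 1) - (j - r + 1)"
    by (rule interval_start_unique[OF n_pos])
      (use missing_flip_interval(1)[OF T] assms(2,3) in blast)
  then have "2 * int n dvd i - j" by simp
  then show ?thesis using rot_cong by simp
qed

text \<open>The two descriptions of \<open>T\<close> as an interval in \<open>missing_flip_interval\<close> must have the same
  starting point.\<close>

lemma missing_flip_dvd:
  assumes T: "T \<in> half_sets n" and miss: "flip i \<notin> sum_set G (dic_set r T)"
  shows "2 * int n dvd 2 * r - 1 - int n"
proof -
  have "2 * int n dvd (i + r + int n) - (i - r + 1)"
    by (rule interval_start_unique[OF n_pos])
      (use missing_flip_interval[OF T miss] in blast)
  then have "2 * int n dvd (i + r + int n) - (i - r + 1) - 2 * int n" by (rule dvd_diff) simp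
  then show ?thesis by (simp add: algebra_simps)
qed

lemma missing_rot:
  assumes "rot i \<notin> sum_set G (dic_set r T)"
  shows "rot i = rot (2 * r - 1)" and "avoids n (2 * r - 1 - int n) T"
proof -
  show eq: "rot i = rot (2 * r - 1)"
    using assms by (auto simp: rot_sum_set intro: rot_cong)
  then have "rot (2 * r - 1) \<notin> sum_set G (dic_set r T)" using assms by simp
  then show "avoids n (2 * r - 1 - int n) T" by (simp add: rot_sum_set)
qed

lemma card_sum_set:
  assumes T: "T \<in> half_sets n" and d: "\<not> 2 * int n dvd 2 * r - 1 - int n"
  shows "card (sum_set G (dic_set r T)) = 4 * n - of_bool (avoids n (2 * r - 1 - int n) T)"
proof -
  let ?M = "carrier G - sum_set G (dic_set r T)"
  have "x = rot (2 * r - 1) \<and> avoids n (2 * r - 1 - int n) T" if "x \<in> ?M" for x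
  proof -
    from that have "x \<in> carrier G" by simp
    then show ?thesis
    proof (cases rule: carrier_cases)
      case (1 i)
      then show ?thesis using that missing_rot[of i r T] by blast
    next
      case (2 i)
      then show ?thesis using that missing_flip_dvd[OF T] d by blast
    qed
  qed
  moreover have "rot (2 * r - 1) \<in> ?M \<longleftrightarrow> avoids n (2 * r - 1 - int n) T"
    by (simp add: rot_sum_set)
  ultimately have "?M = (if avoids n (2 * r - 1 - int n) T then {rot (2 * r - 1)} else {})" by auto
  then have "card ?M = of_bool (avoids n (2 * r - 1 - int n) T)" by simp
  then show ?thesis using card_eq_missing[OF sum_set_carrier, of r T] by simp
qed

text \<open>A full sum set leaves nothing to prove.  Otherwise the sum set misses no power of \<open>a\<close>, because
  \<open>0\<close> is a difference of elements of \<open>T\<close>, so it misses a single \<open>a\<^sup>i b\<close>.  Then \<open>T\<close> is an interval of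
  length \<open>n\<close>, which avoids \<open>n\<close>, and the difference set misses an element too.\<close>

lemma card_diff_le_sum:
  assumes T: "T \<in> half_sets n" and d: "2 * int n dvd 2 * r - 1 - int n"
  shows "card (diff_set G (dic_set r T)) \<le> card (sum_set G (dic_set r T))"
proof (cases "sum_set G (dic_set r T) = carrier G")
  case True
  then show ?thesis
    using card_diff_set[OF T, of r] card_eq_missing[OF sum_set_carrier, of r T] by simp
next
  case False
  let ?M = "carrier G - sum_set G (dic_set r T)"
  have flips: "\<exists>i. x = flip i" if "x \<in> ?M" for x
  proof -
    from that have "x \<in> carrier G" by simp
    then show ?thesis
    proof (cases rule: carrier_cases)
      case (1 i)
      then show ?thesis using that missing_rot(2)[of i r T] not_avoids_zero[OF n_pos T d] by blast
    qed blast
  qed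
  obtain x where x: "x \<in> ?M" using False sum_set_carrier by blast
  then obtain i where i: "x = flip i" using flips by blast
  have "y = x" if "y \<in> ?M" for y
    using that x i flips missing_flip_unique[OF T] by blast
  then have "?M = {x}" using x by blast
  then have "card ?M = 1" by simp
  moreover have "avoids n (int n) T"
    using interval_avoids[OF n_pos] missing_flip_interval(1)[OF T] x i by blast
  ultimately show ?thesis
    using card_diff_set[OF T, of r] card_eq_missing[OF sum_set_carrier, of r T] by simp
qed

lemma MSTD_imp_avoids:
  assumes "T \<in> half_sets n" "MSTD G (dic_set r T)"
  shows "avoids n (int n) T"
  using assms card_diff_set[of T r] card_eq_missing[OF sum_set_carrier, of r T]
  by (auto simp: MSTD_def of_bool_def split: if_splits)

lemma MSTD_iff_even:
  assumes "even n" and T: "T \<in> half_sets n"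
  shows "MSTD G (dic_set r T) \<longleftrightarrow> avoids n (int n) T"
proof -
  have odd: "odd (2 * r - 1 - int n)" using assms by simp
  then have "\<not> 2 * int n dvd 2 * r - 1 - int n" by (metis dvd_mult_left)
  then show ?thesis
    using card_sum_set[OF T] card_diff_set[OF T] not_avoids_half_period[OF n_pos \<open>even n\<close> T odd] n_pos
    by (auto simp: MSTD_def)
qed

lemma MDTS_iff_even:
  assumes "even n" and T: "T \<in> half_sets n"
  shows "MDTS G (dic_set r T) \<longleftrightarrow> avoids n (2 * r - 1 - int n) T"
proof -
  have odd: "odd (2 * r - 1 - int n)" using assms by simp
  then have "\<not> 2 * int n dvd 2 * r - 1 - int n" by (metis dvd_mult_left)
  then show ?thesis
    using card_sum_set[OF T] card_diff_set[OF T] not_avoids_half_period[OF n_pos \<open>even n\<close> T odd] n_pos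
    by (auto simp: MDTS_def)
qed

lemma MSTD_iff_odd:
  assumes "odd n" and T: "T \<in> half_sets n" and d: "\<not> 2 * int n dvd 2 * r - 1 - int n"
  shows "MSTD G (dic_set r T) \<longleftrightarrow> avoids n (int n) T"
proof -
  have "even (2 * r - 1 - int n)" using assms by simp
  then show ?thesis
    using card_sum_set[OF T d] card_diff_set[OF T] not_avoids_even[OF \<open>odd n\<close> T] n_pos
    by (auto simp: MSTD_def)
qed

lemma not_MDTS_odd:
  assumes "odd n" and T: "T \<in> half_sets n"
  shows "\<not> MDTS G (dic_set r T)"
proof (cases "2 * int n dvd 2 * r - 1 - int n")
  case True
  then show ?thesis using card_diff_le_sum[OF T, of r] by (simp add: MDTS_def)
next
  case False
  have "even (2 * r - 1 - int n)" using assms by simp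
  then show ?thesis
    using card_sum_set[OF T False] card_diff_set[OF T] not_avoids_even[OF \<open>odd n\<close> T]
    by (auto simp: MDTS_def)
qed

section \<open>Counting over the family\<close>

lemma interval_image:
  "(\<lambda>k. a [^] k) ` {r..<r + n} = {rot i | i. (i - int r) mod (2 * int n) < int n}"
proof (intro equalityI subsetI)
  fix x assume "x \<in> (\<lambda>k. a [^] k) ` {r..<r + n}"
  then obtain k where k: "x = a [^] k" "r \<le> k" "k < r + n" by auto
  then have "x = rot (int k)" "(int k - int r) mod (2 * int n) < int n"
    by (simp_all add: int_pow_int)
  then show "x \<in> {rot i | i. (i - int r) mod (2 * int n) < int n}" by blast
next
  fix x assume "x \<in> {rot i | i. (i - int r) mod (2 * int n) < int n}"
  then obtain i where i: "x = rot i" "(i - int r) mod (2 * int n) < int n" by blast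
  define e where "e = (i - int r) mod (2 * int n)"
  have e: "0 \<le> e" "e < int n" using i n_pos by (auto simp: e_def)
  have "rot i = rot (int r + e)"
    by (simp add: rot_eq_iff e_def mod_simps)
  also have "\<dots> = a [^] (r + nat e)"
    using e int_pow_int[of G a "r + nat e"] by simp
  finally show "x \<in> (\<lambda>k. a [^] k) ` {r..<r + n}" using i(1) e by auto
qed

lemma rot_image_coset:
  assumes "T \<subseteq> {0..<2 * int n}"
  shows "(rot ` T) #> b = {flip i | i. i mod (2 * int n) \<in> T}"
proof (intro equalityI subsetI)
  fix x assume "x \<in> (rot ` T) #> b"
  then obtain t where t: "t \<in> T" "x = flip t" by (auto simp: r_coset_def)
  then have "t mod (2 * int n) = t" using assms by auto
  then show "x \<in> {flip i | i. i mod (2 * int n) \<in> T}" using t by force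
next
  fix x assume "x \<in> {flip i | i. i mod (2 * int n) \<in> T}"
  then obtain i where i: "i mod (2 * int n) \<in> T" "x = flip i" by blast
  then have "x = flip (i mod (2 * int n))" by (simp add: rot_mod)
  then show "x \<in> (rot ` T) #> b" using i(1) by (auto simp: r_coset_def)
qed

lemma nat_pow_image: "(\<lambda>k. a [^] k) ` {0..<2 * n} = rot ` {0..<2 * int n}"
proof -
  have "{0..<2 * int n} = int ` {0..<2 * n}" by (simp add: image_int_atLeastLessThan)
  then show ?thesis by (simp add: image_image int_pow_int)
qed

lemma dic_family_eq:
  "dic_family G n a b = (\<lambda>(r, T). dic_set r T) ` ({0..int n} \<times> half_sets n)"
proof (intro equalityI subsetI)
  fix A assume "A \<in> dic_family G n a b"
  then obtain r S where A: "A = (\<lambda>k. a [^] k) ` {r..<r + n} \<union> (S #> b)" and r: "r \<le> n"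
    and S: "S \<subseteq> rot ` {0..<2 * int n}" "card S = n"
    unfolding dic_family_def nat_pow_image by blast
  obtain T where T: "T \<subseteq> {0..<2 * int n}" "S = rot ` T" using S(1) by (rule subset_imageE)
  have "card T = n" using S(2) T card_image[OF inj_on_subset[OF inj_on_rot T(1)]] by simp
  then have "T \<in> half_sets n" using T by (simp add: half_sets_def)
  moreover have "A = dic_set (int r) T"
    by (simp add: A interval_image T(2) rot_image_coset[OF T(1)] dic_set_def)
  ultimately show "A \<in> (\<lambda>(r, T). dic_set r T) ` ({0..int n} \<times> half_sets n)" using r by force
next
  fix A assume "A \<in> (\<lambda>(r, T). dic_set r T) ` ({0..int n} \<times> half_sets n)"
  then obtain r T where A: "A = dic_set r T" and r: "0 \<le> r" "r \<le> int n" and T: "T \<in> half_sets n"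
    by auto
  have TN: "T \<subseteq> {0..<2 * int n}" using T by (simp add: half_sets_def)
  have "A = (\<lambda>k. a [^] k) ` {nat r..<nat r + n} \<union> ((rot ` T) #> b)"
    using r by (simp add: A interval_image rot_image_coset[OF TN] dic_set_def)
  moreover have "nat r \<le> n" using r by simp
  moreover have "rot ` T \<subseteq> rot ` {0..<2 * int n}" using TN by blast
  moreover have "card (rot ` T) = n"
    using T card_image[OF inj_on_subset[OF inj_on_rot TN]] by (simp add: half_sets_def)
  ultimately show "A \<in> dic_family G n a b"
    unfolding dic_family_def nat_pow_image by blast
qed

lemma inj_on_dic_set: "inj_on (\<lambda>(r, T). dic_set r T) ({0..int n} \<times> half_sets n)"
proof (rule inj_onI, clarify)
  fix r T r' T'
  assume r: "r \<in> {0..int n}" "r' \<in> {0..int n}" and T: "T \<in> half_sets n" "T' \<in> half_sets n"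
    and eq: "dic_set r T = dic_set r' T'"
  have "2 * int n dvd r - r'"
    by (rule interval_start_unique[OF n_pos]) (metis eq rot_mem_dic_set)
  moreover have "\<bar>r - r'\<bar> < 2 * int n" using r n_pos by auto
  ultimately have "r = r'" using zdvd_imp_le[of "2 * int n" "\<bar>r - r'\<bar>"] by auto
  moreover have "T = T'"
  proof -
    have "x \<in> T \<longleftrightarrow> x \<in> T'" if "x \<in> {0..<2 * int n}" for x
      using that flip_mem_dic_set[of x r T] flip_mem_dic_set[of x r' T'] eq by simp
    then show ?thesis using T by (auto simp: half_sets_def)
  qed
  ultimately show "r = r' \<and> T = T'" by simp
qed

text \<open>The set determines its parameters (\<open>inj_on_dic_set\<close>), so one can count pairs \<open>(r, T)\<close>.\<close>

lemma card_family:
  "card {A \<in> dic_family G n a b. Q A} = (\<Sum>r\<in>{0..int n}. card {T \<in> half_sets n. Q (dic_set r T)})"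
proof -
  let ?f = "\<lambda>(r, T). dic_set r T"
  let ?P = "SIGMA r:{0..int n}. {T \<in> half_sets n. Q (dic_set r T)}"
  have "{A \<in> dic_family G n a b. Q A} = ?f ` ?P"
    unfolding dic_family_eq by auto
  moreover have "inj_on ?f ?P"
    by (rule inj_on_subset[OF inj_on_dic_set]) auto
  ultimately have "card {A \<in> dic_family G n a b. Q A} = card ?P" by (simp add: card_image)
  then show ?thesis using finite_half_sets by simp
qed

lemma card_trichotomy:
  "card {A \<in> dic_family G n a b. MSTD G A} + card {A \<in> dic_family G n a b. MDTS G A}
     + card {A \<in> dic_family G n a b. balanced G A} = (n + 1) * ((2 * n) choose n)"
proof -
  let ?F = "dic_family G n a b"
  have fin: "finite ?F" unfolding dic_family_eq using finite_half_sets by blast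
  have "card ?F = card {A \<in> ?F. MSTD G A} + card {A \<in> ?F. MDTS G A} + card {A \<in> ?F. balanced G A}"
  proof -
    have "?F = {A \<in> ?F. MSTD G A} \<union> {A \<in> ?F. MDTS G A} \<union> {A \<in> ?F. balanced G A}"
      by (auto simp: MSTD_def MDTS_def balanced_def)
    also have "card \<dots> = card ({A \<in> ?F. MSTD G A} \<union> {A \<in> ?F. MDTS G A}) + card {A \<in> ?F. balanced G A}"
      using fin by (intro card_Un_disjoint) (auto simp: MSTD_def MDTS_def balanced_def)
    also have "card ({A \<in> ?F. MSTD G A} \<union> {A \<in> ?F. MDTS G A}) = card {A \<in> ?F. MSTD G A} + card {A \<in> ?F. MDTS G A}"
      using fin by (intro card_Un_disjoint) (auto simp: MSTD_def MDTS_def)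
    finally show ?thesis .
  qed
  moreover have "card ?F = (n + 1) * ((2 * n) choose n)"
    using card_family[of "\<lambda>_. True"] by (simp add: card_half_sets nat_add_distrib)
  ultimately show ?thesis by simp
qed

lemma card_MSTD_le: "card {A \<in> dic_family G n a b. MSTD G A} \<le> (n + 1) * 2 ^ n"
proof -
  have "card {T \<in> half_sets n. MSTD G (dic_set r T)} \<le> 2 ^ n" for r
  proof -
    have "{T \<in> half_sets n. MSTD G (dic_set r T)} \<subseteq> {T \<in> half_sets n. avoids n (int n) T}"
      using MSTD_imp_avoids by blast
    then show ?thesis
      using card_mono[of "{T \<in> half_sets n. avoids n (int n) T}"] finite_half_sets
        card_avoids_half_period[OF n_pos] by fastforce
  qed
  then have "card {A \<in> dic_family G n a b. MSTD G A} \<le> (\<Sum>r\<in>{0..int n}. 2 ^ n)"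
    unfolding card_family by (rule sum_mono)
  then show ?thesis by (simp add: nat_add_distrib)
qed

lemma card_MSTD_even:
  assumes "even n"
  shows "card {A \<in> dic_family G n a b. MSTD G A} = (n + 1) * 2 ^ n"
proof -
  have "{T \<in> half_sets n. MSTD G (dic_set r T)} = {T \<in> half_sets n. avoids n (int n) T}" for r
    using MSTD_iff_even[OF assms] by blast
  then show ?thesis
    unfolding card_family by (simp add: card_avoids_half_period[OF n_pos] nat_add_distrib)
qed

lemma card_MDTS_even_bounds:
  assumes "even n"
  shows "2 * (n + 1) \<le> card {A \<in> dic_family G n a b. MDTS G A}"
    and "card {A \<in> dic_family G n a b. MDTS G A} \<le> (n + 1) * 2 ^ n"
proof -
  have eq: "{T \<in> half_sets n. MDTS G (dic_set r T)}
      = {T \<in> half_sets n. avoids n (2 * r - 1 - int n) T}" for r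
    using MDTS_iff_even[OF assms] by blast
  have odd: "odd (2 * r - 1 - int n)" for r using assms by simp
  have "(\<Sum>r\<in>{0..int n}. 2) \<le> card {A \<in> dic_family G n a b. MDTS G A}"
    unfolding card_family eq by (intro sum_mono card_avoids_odd_ge n_pos odd)
  then show "2 * (n + 1) \<le> card {A \<in> dic_family G n a b. MDTS G A}" by (simp add: nat_add_distrib)
  have "card {A \<in> dic_family G n a b. MDTS G A} \<le> (\<Sum>r\<in>{0..int n}. 2 ^ n)"
    unfolding card_family eq by (intro sum_mono card_avoids_odd_le n_pos odd)
  then show "card {A \<in> dic_family G n a b. MDTS G A} \<le> (n + 1) * 2 ^ n"
    by (simp add: nat_add_distrib)
qed

text \<open>Only the value \<open>r = (n + 1) / 2\<close>, for which \<open>2r - 1 - n = 0\<close>, is discarded; each of the other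
  \<open>n\<close> values contributes \<open>2\<^sup>n\<close> sets.\<close>

lemma card_MSTD_odd_ge:
  assumes "odd n" "n > 1"
  shows "n * 2 ^ n \<le> card {A \<in> dic_family G n a b. MSTD G A}"
proof -
  let ?r = "(int n + 1) div 2"
  have r: "?r \<in> {0..int n}" using assms by auto
  have eq: "{T \<in> half_sets n. MSTD G (dic_set r T)} = {T \<in> half_sets n. avoids n (int n) T}"
    if "r \<in> {0..int n} - {?r}" for r
  proof -
    have "2 * r - 1 - int n \<noteq> 0" using that assms(1) by auto
    moreover have "\<bar>2 * r - 1 - int n\<bar> < 2 * int n" using that assms(2) by auto
    ultimately have "\<not> 2 * int n dvd 2 * r - 1 - int n"
      using zdvd_imp_le[of "2 * int n" "\<bar>2 * r - 1 - int n\<bar>"] by auto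
    then show ?thesis using MSTD_iff_odd[OF assms(1)] by blast
  qed
  have "n * 2 ^ n = (\<Sum>r\<in>{0..int n} - {?r}. 2 ^ n)"
    using r by (simp add: card_Diff_singleton nat_add_distrib)
  also have "\<dots> = (\<Sum>r\<in>{0..int n} - {?r}. card {T \<in> half_sets n. MSTD G (dic_set r T)})"
    using eq card_avoids_half_period[OF n_pos] by (intro sum.cong) auto
  also have "\<dots> \<le> card {A \<in> dic_family G n a b. MSTD G A}"
    unfolding card_family by (intro sum_mono2) auto
  finally show ?thesis .
qed

lemma card_MDTS_odd:
  assumes "odd n"
  shows "card {A \<in> dic_family G n a b. MDTS G A} = 0"
proof -
  have "{T \<in> half_sets n. MDTS G (dic_set r T)} = {}" for r
    using not_MDTS_odd[OF assms] by blast
  then show ?thesis unfolding card_family by (simp only: card.empty sum.neutral_const)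
qed

end

section \<open>The numerical estimates\<close>

lemma central_binomial_ge:
  assumes "m \<ge> 3"
  shows "2 ^ (m + 1) \<le> (2 * m) choose m"
  using assms
proof (induction m rule: dec_induct)
  case base
  then show ?case by (simp add: eval_nat_numeral)
next
  case (step m)
  have "(2 * Suc m) choose (Suc m) = ((2 * m + 1) choose m) + ((2 * m + 1) choose (Suc m))"
    by simp
  moreover have "(2 * m) choose m \<le> (2 * m + 1) choose m"
    by (cases m) auto
  moreover have "(2 * m) choose m \<le> (2 * m + 1) choose (Suc m)"
    by simp
  ultimately show ?case using step.IH by simp
qed

text \<open>Dropping the parity condition, the sum is at most \<open>(2n - 2) choose (n - 2)\<close> by the hockey-stick
  identity.  Two applications of Pascal's rule to \<open>(2n) choose n\<close> produce this term and, in addition,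
  twice the central coefficient \<open>(2n - 2) choose (n - 1)\<close>, which absorbs \<open>2 * 2 ^ n\<close>.\<close>

lemma sum_binomial_le:
  assumes n: "n \<ge> 6"
  shows "(\<Sum>i | i \<in> {3..n + 3} \<and> odd i. (2 * n - i) choose (n - 3)) + 2 * 2 ^ n \<le> (2 * n) choose n"
proof -
  define m where "m = n - 1"
  have m: "n = Suc m" "m \<ge> 3" using n by (auto simp: m_def)
  have "(\<Sum>i | i \<in> {3..n + 3} \<and> odd i. (2 * n - i) choose (n - 3))
      \<le> (\<Sum>i\<in>{3..n + 3}. (2 * n - i) choose (n - 3))"
    by (rule sum_mono2) auto
  also have "\<dots> = (\<Sum>k\<in>(\<lambda>i. 2 * n - i) ` {3..n + 3}. k choose (n - 3))"
    using n by (subst sum.reindex) (auto intro!: inj_onI)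
  also have "\<dots> \<le> (\<Sum>k\<le>2 * n - 3. k choose (n - 3))"
    by (rule sum_mono2) auto
  also have "\<dots> = Suc (2 * n - 3) choose Suc (n - 3)"
    by (rule sum_choose_upper)
  also have "\<dots> = (2 * m) choose (m - 1)"
  proof -
    have "Suc (2 * n - 3) = 2 * m" "Suc (n - 3) = m - 1" using n by (auto simp: m_def)
    then show ?thesis by (simp only:)
  qed
  finally have "(\<Sum>i | i \<in> {3..n + 3} \<and> odd i. (2 * n - i) choose (n - 3)) \<le> (2 * m) choose (m - 1)" .
  moreover have "(2 * n) choose n = 2 * ((2 * m) choose m) + ((2 * m) choose (m - 1)) + ((2 * m) choose Suc m)"
  proof -
    obtain l where l: "m = Suc l" using m by (cases m) auto
    show ?thesis unfolding m(1) l by simp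
  qed
  moreover have "2 * 2 ^ n \<le> 2 * ((2 * m) choose m)"
    using central_binomial_ge[OF m(2)] by (simp add: m(1))
  ultimately show ?thesis by linarith
qed

theorem theorem1p8:
  fixes G (structure) and n :: nat and a b :: 'a
  assumes "dicyclic G n a b"
    and "n \<ge> 6"
  shows "(even n \<longrightarrow>
            int (card {A \<in> dic_family G n a b. MSTD G A}) \<ge> (int n + 1) * (7 * 2 ^ (n - 3) - 4) \<and>
            int (card {A \<in> dic_family G n a b. MDTS G A}) \<ge> 2 * (int n + 1) \<and>
            int (card {A \<in> dic_family G n a b. balanced G A}) \<ge>
              (int n + 1) * (\<Sum>i | i \<in> {3..n + 3} \<and> odd i. int ((2 * n - i) choose (n - 3)))) \<and>
         (odd n \<longrightarrow>
            int (card {A \<in> dic_family G n a b. MSTD G A}) \<ge> (int n + 1) * (7 * 2 ^ (n - 3) - 4) \<and>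
            int (card {A \<in> dic_family G n a b. MDTS G A}) = 0 \<and>
            int (card {A \<in> dic_family G n a b. balanced G A}) \<ge>
              int ((2 * n) choose n) * (int n + 1) - 2 ^ n * (int n + 1))"
proof -
  interpret dicyclic G n a b by fact
  let ?s = "card {A \<in> dic_family G n a b. MSTD G A}"
  let ?d = "card {A \<in> dic_family G n a b. MDTS G A}"
  let ?b = "card {A \<in> dic_family G n a b. balanced G A}"
  have pow: "(2::int) ^ n = 8 * 2 ^ (n - 3)"
  proof -
    have "(2::int) ^ n = 2 ^ (3 + (n - 3))" using assms(2) by simp
    then show ?thesis by (simp only: power_add) simp
  qed
  have total: "int ?s + int ?d + int ?b = (int n + 1) * int ((2 * n) choose n)"
    using arg_cong[OF card_trichotomy, of int] by (simp add: algebra_simps)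
  show ?thesis
  proof (intro conjI impI)
    assume even: "even n"
    have s: "int ?s = (int n + 1) * 2 ^ n"
      using card_MSTD_even[OF even] by (simp add: algebra_simps)
    show "int ?s \<ge> (int n + 1) * (7 * 2 ^ (n - 3) - 4)"
    proof -
      have "(0::int) \<le> 2 ^ (n - 3)" by simp
      then have "7 * 2 ^ (n - 3) - 4 \<le> (8 * 2 ^ (n - 3) :: int)" by linarith
      then show ?thesis unfolding s pow by (rule mult_left_mono) simp
    qed
    show "int ?d \<ge> 2 * (int n + 1)"
      using card_MDTS_even_bounds(1)[OF even] by simp
    have "int ?d \<le> int ((n + 1) * 2 ^ n)"
      using card_MDTS_even_bounds(2)[OF even] by (simp only: of_nat_le_iff)
    then have "int ?b \<ge> (int n + 1) * (int ((2 * n) choose n) - 2 * 2 ^ n)"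
      using total s by (simp add: algebra_simps)
    moreover have "(\<Sum>i | i \<in> {3..n + 3} \<and> odd i. int ((2 * n - i) choose (n - 3)))
        \<le> int ((2 * n) choose n) - 2 * 2 ^ n"
      using zle_int[THEN iffD2, OF sum_binomial_le[OF assms(2)]] by simp
    then have "(int n + 1) * (\<Sum>i | i \<in> {3..n + 3} \<and> odd i. int ((2 * n - i) choose (n - 3)))
        \<le> (int n + 1) * (int ((2 * n) choose n) - 2 * 2 ^ n)"
      by (rule mult_left_mono) simp
    ultimately show "int ?b \<ge> (int n + 1) *
        (\<Sum>i | i \<in> {3..n + 3} \<and> odd i. int ((2 * n - i) choose (n - 3)))"
      by linarith
  next
    assume odd: "odd n"
    then have n7: "n \<ge> 7" using assms(2) by (cases "n = 6") auto
    have "(int n + 1) * (7 * 2 ^ (n - 3) - 4) \<le> (int n + 1) * (7 * 2 ^ (n - 3))"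
      by (intro mult_left_mono) auto
    also have "\<dots> = (7 * int n + 7) * 2 ^ (n - 3)" by (simp add: algebra_simps)
    also have "\<dots> \<le> (8 * int n) * 2 ^ (n - 3)" using n7 by (intro mult_right_mono) auto
    also have "\<dots> = int (n * 2 ^ n)" by (simp add: pow)
    also have "\<dots> \<le> int ?s" using card_MSTD_odd_ge[OF odd] n7 by (simp only: of_nat_le_iff)
    finally show "int ?s \<ge> (int n + 1) * (7 * 2 ^ (n - 3) - 4)" .
    show d: "int ?d = 0" using card_MDTS_odd[OF odd] by simp
    have "int ?s \<le> int ((n + 1) * 2 ^ n)" using card_MSTD_le by (simp only: of_nat_le_iff)
    then show "int ?b \<ge> int ((2 * n) choose n) * (int n + 1) - 2 ^ n * (int n + 1)"
      using total d by (simp add: algebra_simps)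
  qed
qed

end
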